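(* Let $0\le p\le q$ be integers, let $\mathbf{a}=(a_1,\dots,a_p)$ and $\mathbf{b}=(b_1,\dots,b_q)$ be vectors with positive components, and suppose that $\mathbf{a}$ can be re-indexed so that $a_k=b_k+n_k$ with $n_k$ a non-negative integer for each $k=1,\dots,p$. Let $\phi(z)={}_pF_q(\mathbf{a};\mathbf{b};z)$. Then for all integers $n\ge0$ and all $x\in\mathbb{R}$, $$L_n[\phi](x)=\sum_{k=0}^{2n}\frac{(-1)^{k+n}}{(2n)!}\binom{2n}{k}\phi^{(k)}(x)\,\phi^{(2n-k)}(x)\ \ge\ 0 .$$
   Context: ${}_pF_q(\mathbf{a};\mathbf{b};z)=\sum_{m\ge0}\frac{(a_1)_m\cdots(a_p)_m}{(b_1)_m\cdots(b_q)_m\,m!}z^m$ is the generalized hypergeometric function (entire for $p\le q$), with $(a)_m=a(a+1)\cdots(a+m-1)$. $\phi^{(k)}$ denotes the $k$-th derivative. *)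

theory Defs
  imports "HOL-Analysis.Analysis" "HOL-Combinatorics.Permutations"
begin

text \<open>
  The coefficient of \<open>z ^ m\<close> in \<open>fps_hypergeo a b 1\<close> is the product of the Pochhammer symbols
  \<open>pochhammer (a ! i) m\<close> divided by the product of the \<open>pochhammer (b ! j) m\<close> and by \<open>fact m\<close>;
  the list lengths play the roles of \<open>p\<close> and \<open>q\<close>.
\<close>
definition hypergeometric_pFq ::
    "'a list \<Rightarrow> 'a list \<Rightarrow> 'a \<Rightarrow> 'a :: {banach, real_normed_field}" where
  "hypergeometric_pFq a b z = eval_fps (fps_hypergeo a b 1) z"

definition laguerre_expr :: "nat \<Rightarrow> (real \<Rightarrow> real) \<Rightarrow> real \<Rightarrow> real" where
  "laguerre_expr n \<phi> x =
     (\<Sum>k = 0..2 * n. (- 1) ^ (k + n) / fact (2 * n) * of_nat ((2 * n) choose k)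
        * (deriv ^^ k) \<phi> x * (deriv ^^ (2 * n - k)) \<phi> x)"

end

theory Submission
  imports Defs "HOL-Computational_Algebra.Fundamental_Theorem_Algebra"
    "HOL-Real_Asymp.Real_Asymp"
begin

text \<open>
  Write \<open>f(x + i y) f(x - i y) = \<Sum>n. L\<^sub>n[f](x) y^(2 n)\<close>. For a real polynomial
  \<open>f(z) = c \<Prod>(z + r)\<close> with real \<open>r\<close> the left-hand side is \<open>c\<^sup>2 \<Prod>((x + r)\<^sup>2 + y\<^sup>2)\<close>, so every
  \<open>L\<^sub>n[f](x)\<close> is nonnegative (\<open>laguerre_expr_real_rooted_nonneg\<close>). The sign survives limits of such
  polynomials, provided that all derivatives converge. Hence it suffices to exhibit the
  hypergeometric function as a sufficiently well controlled limit of real-rooted polynomials.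

  Start from \<open>(1 + z/(N+1))^N\<close>, which tends to \<open>exp z\<close>. The remaining factors of the coefficients are
  \<open>(b + n)\<^sub>m / (b)\<^sub>m\<close> for the pairs \<open>a\<^sub>k = b\<^sub>k + n\<^sub>k\<close> and \<open>1 / (b)\<^sub>m\<close> for the lower parameters without a
  partner. The first equals \<open>(b + m)\<^sub>n / (b)\<^sub>n\<close>, a polynomial in \<open>m\<close>, and multiplying the \<open>m\<close>-th
  coefficient by it is the same as applying the operators \<open>b + j + z d/dz\<close> for \<open>j < n\<close>, up to a
  constant. The second is the limit of \<open>(b + N)\<^sub>m / ((N+1)^m (b)\<^sub>m)\<close>, which combines such operators with
  a rescaling of \<open>z\<close>. So the whole proof rests on one fact: for \<open>b > 0\<close> the operator \<open>b + z d/dz\<close>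
  keeps the zeros of a polynomial in \<open>(-\<infinity>, 0]\<close> (\<open>nonpos_rooted_euler_operator\<close>).

  The convergence is handled by the bound \<open>K^m / m!\<close> on the \<open>m\<close>-th coefficients, uniform in \<open>N\<close>, which
  allows Tannery's theorem to be applied to the series of every derivative.
\<close>

section \<open>Real polynomials whose zeros are real and nonpositive\<close>

abbreviation cpoly :: "real poly \<Rightarrow> complex \<Rightarrow> complex" where
  "cpoly p \<equiv> poly (map_poly complex_of_real p)"

lemma cpoly_add: "cpoly (p + q) z = cpoly p z + cpoly q z"
proof -
  have "map_poly complex_of_real (p + q) = map_poly of_real p + map_poly of_real q"
    by (intro poly_eqI) (simp add: coeff_map_poly)
  then show ?thesis by simp
qed

lemma cpoly_smult: "cpoly (smult c p) z = of_real c * cpoly p z"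
  by (simp add: map_poly_smult)

lemma cpoly_pCons: "cpoly (pCons a p) z = of_real a + z * cpoly p z"
  by (simp add: map_poly_pCons)

lemma cpoly_mult: "cpoly (p * q) z = cpoly p z * cpoly q z"
  by (induction p) (simp_all add: cpoly_add cpoly_smult cpoly_pCons algebra_simps)

lemma cpoly_power: "cpoly (p ^ n) z = cpoly p z ^ n"
  by (induction n) (simp_all add: cpoly_mult map_poly_1)

lemma cpoly_of_real: "cpoly p (of_real x) = of_real (poly p x)"
  by (induction p) (simp_all add: cpoly_pCons)

text \<open>
  The squares of the \<open>u\<close> with \<open>Re u > 0\<close> are exactly the complex numbers outside \<open>(-\<infinity>, 0]\<close>. Stating
  the location of the zeros through \<open>u\<close> turns the slit plane into a half-plane, whose closure under
  addition and inversion drives the proofs below. The zero polynomial is excluded automatically.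
\<close>
definition nonpos_rooted :: "real poly \<Rightarrow> bool" where
  "nonpos_rooted p \<longleftrightarrow> (\<forall>u. Re u > 0 \<longrightarrow> cpoly p (u\<^sup>2) \<noteq> 0)"

text \<open>
  The principal square root of a zero has nonnegative real part, hence lies on the imaginary axis.
\<close>
lemma nonpos_rooted_root:
  assumes "nonpos_rooted p" "cpoly p z = 0"
  obtains r where "r \<ge> 0" "z = of_real (- r)"
proof -
  have "\<not> Re (csqrt z) > 0"
    using assms by (metis nonpos_rooted_def power2_csqrt)
  then have re: "Re (csqrt z) = 0"
    using csqrt_principal[of z] by linarith
  have "z = (csqrt z)\<^sup>2" by simp
  also have "\<dots> = of_real (- (Im (csqrt z))\<^sup>2)"
    using re by (simp add: complex_eq_iff power2_eq_square)
  finally show ?thesis by (intro that[of "(Im (csqrt z))\<^sup>2"]) auto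
qed

lemma nonpos_rooted_factorization:
  assumes "nonpos_rooted p"
  obtains c rs where "c \<noteq> 0" "\<forall>r\<in>set rs. r \<ge> 0" "p = smult c (\<Prod>r\<leftarrow>rs. [:r, 1:])"
proof -
  have "\<exists>c rs. c \<noteq> 0 \<and> (\<forall>r\<in>set rs. r \<ge> 0) \<and> p = smult c (\<Prod>r\<leftarrow>rs. [:r, 1:])"
    using assms
  proof (induction "degree p" arbitrary: p)
    case 0
    then obtain c where c: "p = [:c:]" by (metis degree_eq_zeroE)
    have "c \<noteq> 0"
      using 0(2) unfolding nonpos_rooted_def c by (auto simp: cpoly_pCons intro: exI[of _ 1])
    then show ?case using c by (intro exI[of _ c] exI[of _ "[]"]) simp
  next
    case (Suc n p)
    have "degree (map_poly complex_of_real p) > 0"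
      using Suc.hyps(2) by (simp add: degree_map_poly)
    then obtain z where z: "cpoly p z = 0"
      using alg_closed_imp_poly_has_root by blast
    then obtain r where r: "r \<ge> 0" "z = of_real (- r)"
      using nonpos_rooted_root Suc.prems by blast
    have "poly p (- r) = 0"
      using z unfolding r(2) cpoly_of_real by simp
    then obtain q where q: "p = [:r, 1:] * q"
      using poly_eq_0_iff_dvd[of p "- r"] by auto
    have "nonpos_rooted q"
      using Suc.prems unfolding nonpos_rooted_def q cpoly_mult by auto
    moreover have "q \<noteq> 0" using Suc.hyps q by auto
    then have "n = degree q"
      using Suc.hyps(2) unfolding q by (subst (asm) degree_mult_eq) auto
    ultimately obtain c rs where
      "c \<noteq> 0" "\<forall>r\<in>set rs. r \<ge> 0" "q = smult c (\<Prod>r\<leftarrow>rs. [:r, 1:])"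
      using Suc.hyps(1) by blast
    then show ?case
      using q r by (intro exI[of _ c] exI[of _ "r # rs"]) simp
  qed
  then show ?thesis using that by blast
qed

text \<open>
  With \<open>z = u\<^sup>2\<close>, the number \<open>w\<close> is \<open>u p'(z) / p(z) = \<Sum> u / (u\<^sup>2 + r) = \<Sum> 1 / (u + r / u)\<close>, and each summand
  has positive real part because \<open>u\<close> and \<open>r / u\<close> lie in the closed right half-plane. The identity
  is stated without division so that the product rule applies directly.
\<close>
lemma cpoly_linear_factors_log_deriv:
  assumes "Re u > 0" "\<forall>r\<in>set rs. r \<ge> 0"
  shows "\<exists>w. Re w \<ge> 0 \<and>
     u * cpoly (pderiv (\<Prod>r\<leftarrow>rs. [:r, 1:])) (u\<^sup>2) = w * cpoly (\<Prod>r\<leftarrow>rs. [:r, 1:]) (u\<^sup>2)"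
  using assms(2)
proof (induction rs)
  case Nil
  then show ?case by (intro exI[of _ 0]) simp
next
  case (Cons r rs)
  let ?q = "\<Prod>r\<leftarrow>rs. [:r, 1:]"
  obtain w where w: "Re w \<ge> 0" "u * cpoly (pderiv ?q) (u\<^sup>2) = w * cpoly ?q (u\<^sup>2)"
    using Cons by auto
  have u0: "u \<noteq> 0" using assms by auto
  \<comment> \<open>The reciprocal of the new summand \<open>u / (u\<^sup>2 + r)\<close>.\<close>
  define v where "v = u + of_real r / u"
  have "Re (of_real r / u) \<ge> 0"
    using assms Cons.prems by (simp add: Re_divide)
  then have v: "Re v > 0" using assms by (simp add: v_def)
  have "Re (1 / v) \<ge> 0" using v by (simp add: Re_divide)
  have uv: "u\<^sup>2 + of_real r = u * v" using u0 by (simp add: v_def power2_eq_square field_simps)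
  have v0: "v \<noteq> 0" using v by auto
  have "u * cpoly (pderiv ([:r, 1:] * ?q)) (u\<^sup>2)
      = u * cpoly ?q (u\<^sup>2) + (u\<^sup>2 + of_real r) * (u * cpoly (pderiv ?q) (u\<^sup>2))"
    unfolding pderiv_mult cpoly_add cpoly_mult
    by (simp add: pderiv_pCons cpoly_pCons algebra_simps)
  also have "\<dots> = u * cpoly ?q (u\<^sup>2) + (u\<^sup>2 + of_real r) * (w * cpoly ?q (u\<^sup>2))"
    unfolding w(2) ..
  also have "\<dots> = (1 / v + w) * ((u\<^sup>2 + of_real r) * cpoly ?q (u\<^sup>2))"
    unfolding uv using v0 by (simp add: field_simps)
  also have "(u\<^sup>2 + of_real r) * cpoly ?q (u\<^sup>2) = cpoly ([:r, 1:] * ?q) (u\<^sup>2)"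
    unfolding cpoly_mult by (simp add: cpoly_pCons algebra_simps)
  finally have "u * cpoly (pderiv ([:r, 1:] * ?q)) (u\<^sup>2)
      = (1 / v + w) * cpoly ([:r, 1:] * ?q) (u\<^sup>2)" .
  then show ?case
    using w(1) \<open>Re (1 / v) \<ge> 0\<close> by (intro exI[of _ "1 / v + w"]) simp
qed

text \<open>
  At \<open>z = u\<^sup>2\<close> the new polynomial is \<open>u p(z) (b / u + w)\<close> with \<open>w\<close> as in the preceding lemma. Since
  \<open>Re (b / u) > 0\<close> and \<open>Re w \<ge> 0\<close>, the last factor cannot vanish.
\<close>
lemma nonpos_rooted_euler_operator:
  assumes "nonpos_rooted p" "b > 0"
  shows "nonpos_rooted (smult b p + pCons 0 (pderiv p))"
  unfolding nonpos_rooted_def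
proof (intro allI impI)
  fix u :: complex
  assume u: "Re u > 0"
  then have u0: "u \<noteq> 0" by auto
  obtain c rs where p: "c \<noteq> 0" "\<forall>r\<in>set rs. r \<ge> 0" "p = smult c (\<Prod>r\<leftarrow>rs. [:r, 1:])"
    using nonpos_rooted_factorization assms by blast
  obtain w where w: "Re w \<ge> 0" "u * cpoly (pderiv p) (u\<^sup>2) = w * cpoly p (u\<^sup>2)"
    using cpoly_linear_factors_log_deriv[OF u p(2)]
    unfolding p(3) pderiv_smult cpoly_smult by (metis mult.left_commute)
  have "Re (of_real b / u) > 0"
    using u assms by (auto simp: Re_divide intro!: divide_pos_pos add_pos_nonneg)
  then have "Re (of_real b / u + w) > 0" using w by simp
  then have "of_real b / u + w \<noteq> 0" by (metis less_irrefl zero_complex.sel(1))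
  moreover have "cpoly p (u\<^sup>2) \<noteq> 0" using assms u by (simp add: nonpos_rooted_def)
  moreover have "cpoly (smult b p + pCons 0 (pderiv p)) (u\<^sup>2)
     = u * ((of_real b / u + w) * cpoly p (u\<^sup>2))"
    unfolding distrib_right w(2)[symmetric]
    using u0 by (simp add: cpoly_add cpoly_smult cpoly_pCons power2_eq_square algebra_simps)
  ultimately show "cpoly (smult b p + pCons 0 (pderiv p)) (u\<^sup>2) \<noteq> 0"
    using u0 by simp
qed

text \<open>
  The operator \<open>b + j + z d/dz\<close> multiplies the \<open>m\<close>-th coefficient by \<open>b + j + m\<close>; the Pochhammer symbol
  arises from the composition over \<open>j < n\<close>.
\<close>
lemma nonpos_rooted_pochhammer_multiplier:
  assumes "nonpos_rooted p" "b > 0"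
  shows "\<exists>q. nonpos_rooted q \<and> (\<forall>m. coeff q m = pochhammer (b + real m) n * coeff p m)"
proof (induction n)
  case 0
  then show ?case using assms by auto
next
  case (Suc n)
  then obtain q where q: "nonpos_rooted q" "\<And>m. coeff q m = pochhammer (b + real m) n * coeff p m"
    by blast
  let ?q = "smult (b + real n) q + pCons 0 (pderiv q)"
  have "coeff ?q m = pochhammer (b + real m) (Suc n) * coeff p m" for m
    by (cases m) (simp_all add: q(2) coeff_pderiv pochhammer_Suc algebra_simps)
  then show ?case
    using nonpos_rooted_euler_operator[OF q(1), of "b + real n"] assms by (intro exI[of _ ?q]) simp
qed

lemma nonpos_rooted_smult: "nonpos_rooted p \<Longrightarrow> c \<noteq> 0 \<Longrightarrow> nonpos_rooted (smult c p)"
  by (simp add: nonpos_rooted_def cpoly_smult)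

lemma coeff_pcompose_monomial: "coeff (pcompose p [:0, s:]) m = s ^ m * coeff p m"
  for s :: "'a :: comm_semiring_1"
proof (induction p arbitrary: m)
  case (pCons a p)
  then show ?case
    by (cases m) (simp_all add: pcompose_pCons coeff_pCons mult.assoc)
qed simp

lemma cpoly_pcompose: "cpoly (pcompose p q) z = cpoly p (cpoly q z)"
  by (induction p) (simp_all add: pcompose_pCons cpoly_add cpoly_mult cpoly_pCons)

lemma nonpos_rooted_rescale:
  assumes "nonpos_rooted p" "s > 0"
  shows "nonpos_rooted (pcompose p [:0, s:])"
  unfolding nonpos_rooted_def
proof (intro allI impI)
  fix u :: complex
  assume u: "Re u > 0"
  have "cpoly [:0, s:] (u\<^sup>2) = (of_real (sqrt s) * u)\<^sup>2"
    using assms by (simp add: cpoly_pCons power_mult_distrib flip: of_real_power)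
  moreover have "Re (of_real (sqrt s) * u) > 0" using u assms by simp
  ultimately show "cpoly (pcompose p [:0, s:]) (u\<^sup>2) \<noteq> 0"
    using assms(1) by (simp add: cpoly_pcompose nonpos_rooted_def)
qed

lemma nonpos_rooted_linear_power:
  assumes "s > 0"
  shows "nonpos_rooted ([:1, s:] ^ n)"
proof -
  have "1 + u\<^sup>2 * of_real s \<noteq> 0" if u: "Re u > 0" for u :: complex
  proof
    assume "1 + u\<^sup>2 * of_real s = 0"
    then have "u * (u * of_real s) = - 1"
      by (simp add: power2_eq_square eq_neg_iff_add_eq_0 algebra_simps)
    then have "u * of_real s = - 1 / u"
      using u by (metis nonzero_mult_div_cancel_left less_irrefl zero_complex.sel(1))
    moreover have "Re (- 1 / u) < 0" "Re (u * of_real s) > 0"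
      using u assms by (auto simp: Re_divide intro!: divide_pos_pos add_pos_nonneg)
    ultimately show False by simp
  qed
  then show ?thesis
    by (simp add: nonpos_rooted_def cpoly_power cpoly_pCons)
qed

section \<open>The Laguerre expressions of a polynomial with real zeros\<close>

lemma higher_deriv_poly: "(deriv ^^ k) (poly p) = poly ((pderiv ^^ k) p)"
  for p :: "real poly"
proof (induction k)
  case (Suc k)
  then show ?case by (auto simp: fun_eq_iff Suc intro!: DERIV_imp_deriv poly_DERIV)
qed simp

lemma poly_higher_pderiv_taylor:
  "poly ((pderiv ^^ k) p) x = fact k * coeff (pcompose p [:x, 1:]) k" for p :: "real poly"
proof -
  have "(pderiv ^^ k) (pcompose p [:x, 1:]) = pcompose ((pderiv ^^ k) p) [:x, 1:]"
    by (induction k) (simp_all add: pderiv_pcompose pderiv_pCons)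
  then have "poly ((pderiv ^^ k) p) x = coeff ((pderiv ^^ k) (pcompose p [:x, 1:])) 0"
    by (simp add: poly_pcompose flip: poly_0_coeff_0)
  then show ?thesis
    by (simp add: coeff_higher_pderiv pochhammer_fact)
qed

text \<open>
  In terms of the Taylor polynomial \<open>D(t) = p(x + t)\<close>, the binomial coefficient and the factorials
  cancel, and the sum becomes the Cauchy product for \<open>D(t) D(-t)\<close>. This is the expansion of
  \<open>p(x + i y) p(x - i y)\<close> with \<open>t = i y\<close>, kept over the reals.
\<close>
lemma laguerre_expr_poly:
  "laguerre_expr n (poly p) x =
     (- 1) ^ n * coeff (pcompose p [:x, 1:] * pcompose p [:x, - 1:]) (2 * n)"
proof -
  let ?d = "coeff (pcompose p [:x, 1:])"
  \<comment> \<open>\<open>D(-t)\<close> is \<open>D\<close> rescaled by \<open>-1\<close>, so its coefficients only change sign.\<close>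
  have refl: "pcompose p [:x, - 1:] = pcompose (pcompose p [:x, 1:]) [:0, - 1:]"
    by (simp add: pcompose_pCons flip: pcompose_assoc)
  have "(- 1) ^ (k + n) / fact (2 * n) * of_nat ((2 * n) choose k)
        * (fact k * ?d k) * (fact (2 * n - k) * ?d (2 * n - k))
      = (- 1) ^ n * (?d k * ((- 1) ^ (2 * n - k) * ?d (2 * n - k)))" if "k \<le> 2 * n" for k
  proof -
    have "(- 1 :: real) ^ k = (- 1) ^ (2 * n - k)"
      using that by (simp add: minus_one_power_iff)
    then show ?thesis
      using that by (simp add: binomial_fact power_add field_simps)
  qed
  then show ?thesis
    unfolding refl coeff_mult coeff_pcompose_monomial sum_distrib_left laguerre_expr_def
      higher_deriv_poly poly_higher_pderiv_taylor atLeast0AtMost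
    by (intro sum.cong) auto
qed

text \<open>
  Each linear factor contributes \<open>(x + r + t) (x + r - t) = (x + r)\<^sup>2 - t\<^sup>2\<close> to \<open>D(t) D(-t)\<close>, and
  multiplication by it preserves the sign pattern \<open>(-1)^n\<close> of the coefficients of \<open>t^(2 n)\<close>.
\<close>
lemma laguerre_expr_real_rooted_nonneg:
  "laguerre_expr n (poly (smult c (\<Prod>r\<leftarrow>rs. [:r, 1:]))) x \<ge> 0"
proof -
  let ?E = "\<lambda>rs. pcompose (\<Prod>r\<leftarrow>rs. [:r, 1:]) [:x, 1:] * pcompose (\<Prod>r\<leftarrow>rs. [:r, 1:]) [:x, - 1:]"
  have "(- 1) ^ n * coeff (?E rs) (2 * n) \<ge> 0"
  proof (induction rs arbitrary: n)
    case Nil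
    then show ?case by (simp add: coeff_pCons pcompose_1 split: nat.splits)
  next
    case (Cons r rs)
    have "?E (r # rs) = (pcompose [:r, 1:] [:x, 1:] * pcompose [:r, 1:] [:x, - 1:]) * ?E rs"
      unfolding list.map prod_list.Cons pcompose_mult by (simp only: mult_ac)
    also have "pcompose [:r, 1:] [:x, 1:] * pcompose [:r, 1:] [:x, - 1:] = [:(x + r)\<^sup>2, 0, - 1:]"
      by (simp add: pcompose_pCons power2_eq_square algebra_simps)
    also have "[:(x + r)\<^sup>2, 0, - 1:] * ?E rs
        = smult ((x + r)\<^sup>2) (?E rs) - pCons 0 (pCons 0 (?E rs))"
      by simp
    finally have eq: "?E (r # rs) = smult ((x + r)\<^sup>2) (?E rs) - pCons 0 (pCons 0 (?E rs))" .
    show ?case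
    proof (cases n)
      case 0
      then show ?thesis unfolding eq using Cons.IH[of 0] by simp
    next
      case (Suc k)
      have "(- 1) ^ n * coeff (?E (r # rs)) (2 * n)
          = (x + r)\<^sup>2 * ((- 1) ^ n * coeff (?E rs) (2 * n)) + (- 1) ^ k * coeff (?E rs) (2 * k)"
        unfolding eq by (simp add: Suc algebra_simps)
      also have "\<dots> \<ge> 0"
        using Cons.IH[of n] Cons.IH[of k] by simp
      finally show ?thesis .
    qed
  qed
  then have "c\<^sup>2 * ((- 1) ^ n * coeff (?E rs) (2 * n)) \<ge> 0" by simp
  then show ?thesis
    by (simp add: laguerre_expr_poly pcompose_smult power2_eq_square mult_ac)
qed

section \<open>Passing to entire limits\<close>

lemma higher_deriv_eval_fps:
  fixes f :: "'a :: {banach, real_normed_field} fps"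
  assumes "fps_conv_radius f = \<infinity>"
  shows "(deriv ^^ k) (eval_fps f) = eval_fps ((fps_deriv ^^ k) f)"
  using assms
proof (induction k arbitrary: f)
  case (Suc k)
  have "deriv (eval_fps f) = eval_fps (fps_deriv f)"
    using Suc.prems by (intro ext) (simp add: eval_fps_deriv)
  moreover have "fps_conv_radius (fps_deriv f) = \<infinity>"
    using fps_conv_radius_deriv[of f] Suc.prems by simp
  ultimately show ?case
    using Suc.IH by (simp add: funpow_Suc_right del: funpow.simps)
qed simp

lemma fps_nth_higher_deriv:
  "fps_nth ((fps_deriv ^^ k) f) m = pochhammer (of_nat (Suc m)) k * fps_nth f (m + k)"
  for f :: "'a :: comm_ring_1 fps"
  by (induction k arbitrary: m) (simp_all add: pochhammer_rec algebra_simps)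

lemma fps_conv_radius_exp_bounded:
  fixes f :: "real fps"
  assumes "\<And>m. \<bar>fps_nth f m\<bar> \<le> K ^ m / fact m"
  shows "fps_conv_radius f = \<infinity>"
  unfolding fps_conv_radius_def
proof (rule conv_radius_inftyI'')
  fix z :: real
  have "norm (fps_nth f m * z ^ m) \<le> inverse (fact m) * (K * \<bar>z\<bar>) ^ m" for m
    using mult_right_mono[OF assms[of m], of "\<bar>z\<bar> ^ m"]
    by (simp add: abs_mult power_abs power_mult_distrib divide_inverse mult_ac)
  then show "summable (\<lambda>m. fps_nth f m * z ^ m)"
    by (intro summable_comparison_test'[OF summable_exp[of "K * \<bar>z\<bar>"], of 0])
qed

text \<open>
  Differentiating \<open>k\<close> times turns the bound \<open>K^(m+k) / (m+k)!\<close> into \<open>K^k K^m / m!\<close>, so the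
  differentiated series are dominated by an exponential series uniformly in \<open>N\<close>, and Tannery's
  theorem permits the termwise limit.
\<close>
lemma higher_deriv_eval_fps_tendsto:
  fixes f :: "nat \<Rightarrow> real fps"
  assumes bound: "\<And>N m. \<bar>fps_nth (f N) m\<bar> \<le> K ^ m / fact m"
    and lim: "\<And>m. (\<lambda>N. fps_nth (f N) m) \<longlonglongrightarrow> fps_nth g m"
  shows "(\<lambda>N. (deriv ^^ k) (eval_fps (f N)) x) \<longlonglongrightarrow> (deriv ^^ k) (eval_fps g) x"
proof -
  have boundg: "\<bar>fps_nth g m\<bar> \<le> K ^ m / fact m" for m
    by (rule tendsto_upperbound[OF tendsto_rabs[OF lim]]) (use bound in auto)
  have eval: "(deriv ^^ k) (eval_fps h) x
      = (\<Sum>m. pochhammer (real (Suc m)) k * fps_nth h (m + k) * x ^ m)"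
    if "\<And>m. \<bar>fps_nth h m\<bar> \<le> K ^ m / fact m" for h
    unfolding higher_deriv_eval_fps[OF fps_conv_radius_exp_bounded[of h, OF that]]
      eval_fps_def fps_nth_higher_deriv ..
  have le: "norm (pochhammer (real (Suc m)) k * fps_nth (f N) (m + k) * x ^ m)
      \<le> K ^ k * (inverse (fact m) * (K * \<bar>x\<bar>) ^ m)" for m N
  proof -
    have "fact (m + k) = fact m * pochhammer (real (Suc m)) k"
      using pochhammer_product'[of "1 :: real" m k] by (simp add: pochhammer_fact)
    then have poch: "pochhammer (real (Suc m)) k = fact (m + k) / fact m" by simp
    have "norm (pochhammer (real (Suc m)) k * fps_nth (f N) (m + k) * x ^ m)
        = fact (m + k) / fact m * \<bar>x\<bar> ^ m * \<bar>fps_nth (f N) (m + k)\<bar>"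
      unfolding poch by (simp add: abs_mult power_abs)
    also have "\<dots> \<le> fact (m + k) / fact m * \<bar>x\<bar> ^ m * (K ^ (m + k) / fact (m + k))"
      by (intro mult_left_mono bound) simp
    also have "\<dots> = K ^ k * (inverse (fact m) * (K * \<bar>x\<bar>) ^ m)"
      by (simp add: power_add power_mult_distrib field_simps)
    finally show ?thesis .
  qed
  have "(\<lambda>N. \<Sum>m. pochhammer (real (Suc m)) k * fps_nth (f N) (m + k) * x ^ m)
     \<longlonglongrightarrow> (\<Sum>m. pochhammer (real (Suc m)) k * fps_nth g (m + k) * x ^ m)"
  proof (rule tannerys_theorem[THEN conjunct2, THEN conjunct2])
    show "summable (\<lambda>m. K ^ k * (inverse (fact m) * (K * \<bar>x\<bar>) ^ m))"
      by (intro summable_mult summable_exp)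
    show "\<forall>\<^sub>F (m, N) in at_top \<times>\<^sub>F sequentially.
       norm (pochhammer (real (Suc m)) k * fps_nth (f N) (m + k) * x ^ m)
         \<le> K ^ k * (inverse (fact m) * (K * \<bar>x\<bar>) ^ m)"
      using le by (intro always_eventually) blast
  qed (auto intro!: tendsto_intros lim)
  then show ?thesis
    by (simp only: eval[OF bound] eval[OF boundg])
qed

text \<open>
  The coefficient sequences of suitably controlled limits of the polynomials above. The bound
  \<open>K^m / m!\<close> makes all derivatives converge. The restriction on the degree is what keeps the class
  closed under multipliers depending on \<open>N\<close>: these need to be bounded for \<open>m \<le> N\<close> only.
\<close>
definition nonpos_rooted_limit :: "(nat \<Rightarrow> real) \<Rightarrow> bool" where
  "nonpos_rooted_limit c \<longleftrightarrow> (\<exists>P K.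
     (\<forall>N. nonpos_rooted (P N) \<and> degree (P N) \<le> N \<and> (\<forall>m. \<bar>coeff (P N) m\<bar> \<le> K ^ m / fact m)) \<and>
     (\<forall>m. (\<lambda>N. coeff (P N) m) \<longlonglongrightarrow> c m))"

lemma nonpos_rooted_limit_laguerre_nonneg:
  assumes "nonpos_rooted_limit c"
  shows "laguerre_expr n (eval_fps (Abs_fps c)) x \<ge> 0"
proof -
  obtain P K where P: "\<And>N. nonpos_rooted (P N)" "\<And>N m. \<bar>coeff (P N) m\<bar> \<le> K ^ m / fact m"
      "\<And>m. (\<lambda>N. coeff (P N) m) \<longlonglongrightarrow> c m"
    using assms unfolding nonpos_rooted_limit_def by blast
  have poly: "poly (P N) = eval_fps (fps_of_poly (P N))" for N
    by (intro ext) simp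
  have lim: "(\<lambda>N. (deriv ^^ k) (poly (P N)) x) \<longlonglongrightarrow> (deriv ^^ k) (eval_fps (Abs_fps c)) x" for k
    unfolding poly by (rule higher_deriv_eval_fps_tendsto[where K = K]) (simp_all add: P)
  have "(\<lambda>N. laguerre_expr n (poly (P N)) x) \<longlonglongrightarrow> laguerre_expr n (eval_fps (Abs_fps c)) x"
    unfolding laguerre_expr_def by (intro tendsto_intros lim)
  moreover have "laguerre_expr n (poly (P N)) x \<ge> 0" for N
    using nonpos_rooted_factorization[OF P(1)[of N]] laguerre_expr_real_rooted_nonneg by metis
  ultimately show ?thesis
    by (intro tendsto_lowerbound[of _ _ sequentially]) auto
qed

section \<open>Multipliers of hypergeometric type\<close>

lemma nonpos_rooted_limit_exp: "nonpos_rooted_limit (\<lambda>m. 1 / fact m)"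
proof -
  \<comment> \<open>Scaling by \<open>N + 1\<close> instead of \<open>N\<close> keeps the scale positive for \<open>N = 0\<close>.\<close>
  define P where "P N = [:1, 1 / (real N + 1):] ^ N" for N
  have coeff: "coeff (P N) m = real (N choose m) / (real N + 1) ^ m" for N m
  proof (cases "m \<le> N")
    case True
    then show ?thesis by (simp add: P_def coeff_linear_poly_power power_one_over)
  next
    case False
    have "degree (P N) \<le> degree [:1, 1 / (real N + 1):] * N"
      unfolding P_def by (rule degree_power_le)
    with False show ?thesis by (simp add: coeff_eq_0)
  qed
  have "nonpos_rooted (P N)" for N
    unfolding P_def by (rule nonpos_rooted_linear_power) simp
  moreover have "degree (P N) \<le> N" for N
    by (intro degree_le) (simp add: coeff)
  moreover have "\<bar>coeff (P N) m\<bar> \<le> 1 ^ m / fact m" for N m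
  proof -
    have "real (N choose m) * fact m \<le> real N ^ m"
      using binomial_fact_pow[of N m] by (metis of_nat_fact of_nat_le_iff of_nat_mult of_nat_power)
    also have "\<dots> \<le> (real N + 1) ^ m" by (intro power_mono) auto
    finally show ?thesis by (simp add: coeff field_simps)
  qed
  moreover have "(\<lambda>N. coeff (P N) m) \<longlonglongrightarrow> 1 / fact m" for m
  proof (induction m)
    case 0
    then show ?case by (simp add: coeff)
  next
    case (Suc m)
    have step: "coeff (P N) (Suc m)
        = coeff (P N) m * ((real N - real m) / (real N + 1)) / real (Suc m)" for N
      unfolding coeff binomial_gbinomial gbinomial_pochhammer
      by (simp add: pochhammer_Suc field_simps)
    have "(\<lambda>N. (real N - real m) / (real N + 1)) \<longlonglongrightarrow> 1"
      by real_asymp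
    then have "(\<lambda>N. coeff (P N) (Suc m)) \<longlonglongrightarrow> 1 / fact m * 1 / real (Suc m)"
      unfolding step by (intro tendsto_divide tendsto_mult Suc tendsto_const) auto
    then show ?case by (simp add: mult.commute)
  qed
  ultimately show ?thesis
    unfolding nonpos_rooted_limit_def by (intro exI[of _ P] exI[of _ 1]) blast
qed

text \<open>
  The identity \<open>(b)\<^sub>m (b + m)\<^sub>n = (b)\<^sub>n (b + n)\<^sub>m\<close> (both sides are the product of the
  \<open>b + j\<close> over \<open>j < m + n\<close>) turns the
  Pochhammer symbol in \<open>b + m\<close>, produced by the differential operators, into the ratio
  \<open>(b + n)\<^sub>m / (b)\<^sub>m\<close> of hypergeometric coefficients; the powers of \<open>s\<close> come from rescaling the variable.
  Both \<open>n\<close> and \<open>s\<close> may vary along the approximating sequence.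
\<close>
lemma nonpos_rooted_limit_multiplier:
  assumes c: "nonpos_rooted_limit c" and b: "b > 0" and s: "\<And>N. s N > 0"
    and C: "C \<ge> 0"
      "\<And>N m. m \<le> N \<Longrightarrow> s N ^ m * pochhammer (b + real (\<nu> N)) m / pochhammer b m \<le> C ^ m"
    and lim: "\<And>m. (\<lambda>N. s N ^ m * pochhammer (b + real (\<nu> N)) m / pochhammer b m) \<longlonglongrightarrow> w m"
  shows "nonpos_rooted_limit (\<lambda>m. w m * c m)"
proof -
  obtain P K where P: "\<And>N. nonpos_rooted (P N)" "\<And>N. degree (P N) \<le> N"
      "\<And>N m. \<bar>coeff (P N) m\<bar> \<le> K ^ m / fact m" "\<And>m. (\<lambda>N. coeff (P N) m) \<longlonglongrightarrow> c m"
    using c unfolding nonpos_rooted_limit_def by blast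
  have K: "K \<ge> 0" using P(3)[of 0 1] by simp
  have bpos: "pochhammer b m > 0" for m using b by (rule pochhammer_pos)
  define v where "v N m = s N ^ m * pochhammer (b + real (\<nu> N)) m / pochhammer b m" for N m
  have v_nonneg: "v N m \<ge> 0" for N m
    unfolding v_def using s[of N] b by (intro divide_nonneg_pos mult_nonneg_nonneg bpos)
      (auto intro!: pochhammer_nonneg)
  have "\<exists>q. nonpos_rooted q \<and> (\<forall>m. coeff q m = v N m * coeff (P N) m)" for N
  proof -
    obtain q where q: "nonpos_rooted q"
      "\<And>m. coeff q m = pochhammer (b + real m) (\<nu> N) * coeff (P N) m"
      using nonpos_rooted_pochhammer_multiplier[OF P(1) b] by blast
    define q' where "q' = smult (1 / pochhammer b (\<nu> N)) (pcompose q [:0, s N:])"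
    have "nonpos_rooted q'"
      unfolding q'_def using bpos[of "\<nu> N"]
      by (intro nonpos_rooted_smult nonpos_rooted_rescale q s) auto
    moreover have "coeff q' m = v N m * coeff (P N) m" for m
    proof -
      have "pochhammer b m * pochhammer (b + real m) (\<nu> N)
          = pochhammer b (\<nu> N) * pochhammer (b + real (\<nu> N)) m"
        by (metis pochhammer_product' add.commute)
      then show ?thesis
        using bpos[of m] bpos[of "\<nu> N"]
        by (simp add: q'_def v_def coeff_pcompose_monomial q(2) field_simps)
    qed
    ultimately show ?thesis by blast
  qed
  then obtain Q where Q: "\<And>N. nonpos_rooted (Q N)"
      "\<And>N m. coeff (Q N) m = v N m * coeff (P N) m"
    by metis
  have zero: "coeff (Q N) m = 0" if "m > N" for N m
    using P(2)[of N] that by (simp add: Q(2) coeff_eq_0)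
  have "degree (Q N) \<le> N" for N
    by (intro degree_le) (simp add: zero)
  moreover have "\<bar>coeff (Q N) m\<bar> \<le> (C * K) ^ m / fact m" for N m
  proof (cases "m \<le> N")
    case True
    have "\<bar>coeff (Q N) m\<bar> = v N m * \<bar>coeff (P N) m\<bar>"
      using v_nonneg[of N m] by (simp add: Q(2) abs_mult)
    also have "\<dots> \<le> C ^ m * (K ^ m / fact m)"
      using C(2)[OF True] C(1) P(3) by (intro mult_mono) (auto simp: v_def)
    finally show ?thesis by (simp add: power_mult_distrib)
  next
    case False
    then show ?thesis using zero[of N m] C(1) K by simp
  qed
  moreover have "(\<lambda>N. coeff (Q N) m) \<longlonglongrightarrow> w m * c m" for m
    unfolding Q(2) v_def by (intro tendsto_mult lim P)
  ultimately show ?thesis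
    unfolding nonpos_rooted_limit_def using Q(1) by blast
qed

lemma pochhammer_ratio_prod:
  fixes b :: real
  shows "s ^ m * pochhammer (b + t) m / pochhammer b m
    = (\<Prod>j<m. s * (b + t + real j) / (b + real j))"
  by (simp add: pochhammer_prod prod.distrib prod_dividef atLeast0LessThan)

text \<open>
  A lower parameter \<open>b\<close> paired with the upper parameter \<open>b + n\<close>. Each of the \<open>m\<close> factors
  \<open>(b + n + j) / (b + j)\<close> of the multiplier is at most its value at \<open>j = 0\<close>.
\<close>
lemma nonpos_rooted_limit_mult_shifted_pochhammer:
  assumes "nonpos_rooted_limit c" "b > 0"
  shows "nonpos_rooted_limit (\<lambda>m. pochhammer (b + real n) m / pochhammer b m * c m)"
proof (rule nonpos_rooted_limit_multiplier[where s = "\<lambda>_. 1" and \<nu> = "\<lambda>_. n" and C = "(b + real n) / b"])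
  fix N m :: nat
  have "(\<Prod>j<m. 1 * (b + real n + real j) / (b + real j)) \<le> (\<Prod>j<m. (b + real n) / b)"
    using assms(2) by (intro prod_mono) (auto simp: field_simps)
  then show "1 ^ m * pochhammer (b + real n) m / pochhammer b m \<le> ((b + real n) / b) ^ m"
    unfolding pochhammer_ratio_prod by simp
qed (use assms in auto)

text \<open>
  An unpaired lower parameter. As \<open>N\<close> grows, \<open>(b + N + j) / (N + 1)\<close> tends to \<open>1\<close>, so
  \<open>(b + N)\<^sub>m / ((N + 1)^m (b)\<^sub>m)\<close> tends to \<open>1 / (b)\<^sub>m\<close>. For \<open>j \<le> N\<close> the quotient is at most \<open>b + 2\<close>, which
  gives the exponential bound on the multiplier in the range \<open>m \<le> N\<close>.
\<close>
lemma nonpos_rooted_limit_divide_pochhammer: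
  assumes "nonpos_rooted_limit c" "b > 0"
  shows "nonpos_rooted_limit (\<lambda>m. 1 / pochhammer b m * c m)"
proof (rule nonpos_rooted_limit_multiplier[where s = "\<lambda>N. 1 / (real N + 1)" and \<nu> = "\<lambda>N. N"
      and C = "(b + 2) / b"])
  fix N m :: nat
  assume "m \<le> N"
  have "(\<Prod>j<m. 1 / (real N + 1) * (b + real N + real j) / (b + real j)) \<le> (\<Prod>j<m. (b + 2) / b)"
  proof (intro prod_mono conjI)
    fix j assume "j \<in> {..<m}"
    then have "real j \<le> real N" using \<open>m \<le> N\<close> by simp
    then have "b + real N + real j \<le> (b + 2) * (real N + 1)"
    proof -
      have "(b + 2) * (real N + 1) = b * real N + b + 2 * real N + 2"
        by (simp add: algebra_simps)
      moreover have "b * real N \<ge> 0" using assms(2) by simp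
      ultimately show ?thesis using \<open>real j \<le> real N\<close> by linarith
    qed
    then have "1 / (real N + 1) * (b + real N + real j) \<le> b + 2"
      by (simp add: field_simps)
    then show "1 / (real N + 1) * (b + real N + real j) / (b + real j) \<le> (b + 2) / b"
      using assms(2) by (intro frac_le) auto
  qed (use assms(2) in auto)
  then show "(1 / (real N + 1)) ^ m * pochhammer (b + real N) m / pochhammer b m \<le> ((b + 2) / b) ^ m"
    unfolding pochhammer_ratio_prod by simp
next
  fix m
  have "(\<lambda>N. \<Prod>j<m. 1 / (real N + 1) * (b + real N + real j) / (b + real j))
      \<longlonglongrightarrow> (\<Prod>j<m. 1 / (b + real j))"
  proof (intro tendsto_prod)
    fix j
    have "(\<lambda>N. 1 / (real N + 1) * (b + real N + real j)) \<longlonglongrightarrow> 1"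
      by real_asymp
    then show "(\<lambda>N. 1 / (real N + 1) * (b + real N + real j) / (b + real j)) \<longlonglongrightarrow> 1 / (b + real j)"
      using assms(2) by (intro tendsto_divide tendsto_const) auto
  qed
  moreover have "(\<Prod>j<m. 1 / (b + real j)) = 1 / pochhammer b m"
    by (simp add: pochhammer_prod prod_dividef atLeast0LessThan)
  ultimately show "(\<lambda>N. (1 / (real N + 1)) ^ m * pochhammer (b + real N) m / pochhammer b m)
      \<longlonglongrightarrow> 1 / pochhammer b m"
    unfolding pochhammer_ratio_prod by simp
qed (use assms in auto)

lemma foldl_times_conv_prod_nth:
  "foldl (\<lambda>r x. r * f x) 1 xs = (\<Prod>i<length xs. f (xs ! i))"
  for f :: "'a \<Rightarrow> 'b :: comm_monoid_mult"
  by (induction xs rule: rev_induct) (auto simp: nth_append intro!: arg_cong2[where f = times] prod.cong)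

theorem corollary2:
  fixes a b :: "real list" and n :: nat and x :: real
  assumes "length a \<le> length b"
    and "\<forall>i < length a. 0 < a ! i"
    and "\<forall>j < length b. 0 < b ! j"
    and "\<exists>\<pi> m. \<pi> permutes {..<length a} \<and>
           (\<forall>k < length a. a ! \<pi> k = b ! k + real (m k))"
  shows "laguerre_expr n (hypergeometric_pFq a b) x \<ge> 0"
proof -
  obtain \<pi> \<nu> where \<pi>: "\<pi> permutes {..<length a}"
    and a: "\<And>k. k < length a \<Longrightarrow> a ! \<pi> k = b ! k + real (\<nu> k)"
    using assms(4) by blast
  define w where "w k m = (if k < length a then pochhammer (b ! k + real (\<nu> k)) m else 1)
      / pochhammer (b ! k) m" for k m
  \<comment> \<open>The re-indexing of the upper parameters disappears in their product, and each of the
    \<open>length b\<close> lower parameters gets its own multiplier.\<close>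
  have coeff: "fps_nth (fps_hypergeo a b 1) m = (\<Prod>k<length b. w k m) * (1 / fact m)" for m
  proof -
    have "(\<Prod>i<length a. pochhammer (a ! i) m) = (\<Prod>k<length a. pochhammer (a ! \<pi> k) m)"
      using prod.permute[OF \<pi>, of "\<lambda>i. pochhammer (a ! i) m"] by (simp add: o_def)
    also have "\<dots> = (\<Prod>k<length a. pochhammer (b ! k + real (\<nu> k)) m)"
      by (intro prod.cong) (auto simp: a)
    also have "\<dots> = (\<Prod>k<length b. if k < length a then pochhammer (b ! k + real (\<nu> k)) m else 1)"
      using assms(1) by (intro prod.mono_neutral_cong_left) auto
    finally show ?thesis
      by (simp add: foldl_times_conv_prod_nth w_def prod_dividef)
  qed
  have "nonpos_rooted_limit (\<lambda>m. (\<Prod>k<q. w k m) * (1 / fact m))" if "q \<le> length b" for q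
    using that
  proof (induction q)
    case 0
    then show ?case by (simp add: nonpos_rooted_limit_exp)
  next
    case (Suc q)
    then have IH: "nonpos_rooted_limit (\<lambda>m. (\<Prod>k<q. w k m) * (1 / fact m))" and bq: "b ! q > 0"
      using assms(3) by auto
    have "nonpos_rooted_limit (\<lambda>m. w q m * ((\<Prod>k<q. w k m) * (1 / fact m)))"
      unfolding w_def[of q]
      using nonpos_rooted_limit_mult_shifted_pochhammer[OF IH bq, of "\<nu> q"]
        nonpos_rooted_limit_divide_pochhammer[OF IH bq]
      by (cases "q < length a") simp_all
    then show ?case by (simp add: mult_ac)
  qed
  then have "nonpos_rooted_limit (\<lambda>m. fps_nth (fps_hypergeo a b 1) m)"
    unfolding coeff by blast
  moreover have "hypergeometric_pFq a b = eval_fps (Abs_fps (fps_nth (fps_hypergeo a b 1)))"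
    by (intro ext) (simp add: hypergeometric_pFq_def fps_nth_inverse del: fps_hypergeo_nth)
  ultimately show ?thesis
    using nonpos_rooted_limit_laguerre_nonneg by metis
qed

end
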